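(* Let $T:X\to X$ be a continuous map preserving an ergodic probability measure $\mu$ on a compact space $X$. Consider a subadditive cocycle $u:\mathbb N\times X\to\mathbb R$ such that $u(n,x)/n$ converges to $0$ for $\mu$-almost every $x$, and $u(n,\cdot)$ is continuous for all $n$. Let also $\epsilon>0$. Define a function $$F(x)=\sup_{n\geq0}\bigl(|u(n,x)|-\epsilon n\bigr).$$ Assume that $u$ has exponential large deviations, and that the Birkhoff sums of continuous functions also have exponential large deviations. Let $\delta>0$. Then there exists $C>0$ such that, for any $n\geq0$, $$\mu\{x:\ \mathrm{Card}\{j\in[0,n-1]:F(T^jx)>C\}\geq\delta n\}\leq Ce^{-C^{-1}n}.$$
   Context: Subadditive cocycle: $u(m+n,x)\leq u(m,x)+u(n,T^mx)$ for all $m,n\in\mathbb N$, $x\in X$. If $u_n:X\to\mathbb R$ is a family of functions with $u_n(x)/n\to\lambda$ for $\mu$-a.e. $x$, it has exponential large deviations if for every $\eta>0$ there is $C>0$ such that for all $n\geq0$, $\mu\{x:|u_n(x)-n\lambda|\geq n\eta\}\leq Ce^{-C^{-1}n}$. Thus "$u$ has exponential large deviations" refers to the family $u(n,\cdot)$ with $\lambda=0$, and "Birkhoff sums of continuous functions have exponential large deviations" means that for every continuous $f:X\to\mathbb R$ the family $S_nf=\sum_{j=0}^{n-1}f\circ T^j$ has exponential large deviations (with $\lambda=\int f\,d\mu$). The function $F$ may take the value $+\infty$. *)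

theory Defs
  imports "HOL-Probability.Probability"
begin

locale ergodic_system = prob_space M for M :: "'a measure" +
  fixes T :: "'a \<Rightarrow> 'a"
  assumes T_measurable: "T \<in> measurable M M"
    and T_preserves: "distr M M T = M"
    and T_ergodic: "\<And>A. A \<in> sets M \<Longrightarrow> T -` A \<inter> space M = A \<Longrightarrow> measure M A = 0 \<or> measure M A = 1"

definition subadditive_cocycle :: "('a \<Rightarrow> 'a) \<Rightarrow> (nat \<Rightarrow> 'a \<Rightarrow> real) \<Rightarrow> bool" where
  "subadditive_cocycle T u \<longleftrightarrow> (\<forall>m n x. u (m + n) x \<le> u m x + u n ((T ^^ m) x))"

definition birkhoff_sum :: "('a \<Rightarrow> 'a) \<Rightarrow> ('a \<Rightarrow> real) \<Rightarrow> nat \<Rightarrow> 'a \<Rightarrow> real" where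
  "birkhoff_sum T f n x = (\<Sum>j<n. f ((T ^^ j) x))"

text \<open>The number l plays the role of the almost sure limit of \<open>v n x / n\<close>. This convergence is
  not part of the definition: it is assumed separately where it is needed.\<close>

definition exp_large_deviations :: "'a measure \<Rightarrow> (nat \<Rightarrow> 'a \<Rightarrow> real) \<Rightarrow> real \<Rightarrow> bool" where
  "exp_large_deviations M v l \<longleftrightarrow>
    (\<forall>\<eta>>0. \<exists>C>0. \<forall>n.
      measure M {x \<in> space M. \<bar>v n x - real n * l\<bar> \<ge> real n * \<eta>} \<le> C * exp (- (real n / C)))"

text \<open>The supremum may be infinite, hence the extended real values.\<close>

definition sup_excess :: "(nat \<Rightarrow> 'a \<Rightarrow> real) \<Rightarrow> real \<Rightarrow> 'a \<Rightarrow> ereal" where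
  "sup_excess u \<epsilon> x = (SUP n. ereal (\<bar>u n x\<bar> - \<epsilon> * real n))"

end

theory Submission
  imports Defs "HOL-Real_Asymp.Real_Asymp"
begin

text \<open>By subadditivity, \<open>u m x \<le> \<epsilon>' m + birkhoff_sum T h m x + D\<close>, where
  \<open>h = max (u N / N - \<epsilon>') 0\<close> is continuous and has a small integral when \<open>N\<close> is large.
  If the supremum defining \<open>F\<close> is large at many points of an orbit segment, each of these points
  starts a time interval along which either the Birkhoff sum of \<open>h\<close> is large or \<open>u\<close> is very
  negative. Choose disjoint such intervals greedily from the left. In the first case the Birkhoff sum
  of the nonnegative function \<open>h\<close> along the whole orbit is large. In the second case the upper bound
  controls \<open>u\<close> along the gaps, the constant \<open>D\<close> of each gap being absorbed by the threshold on
  \<open>F\<close> at the next interval, so \<open>u\<close> is very negative along the whole orbit. Both events are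
  exponentially unlikely.\<close>

section \<open>Subadditive cocycles and their comparison with Birkhoff sums\<close>

lemma subadditive_cocycleD:
  "subadditive_cocycle T u \<Longrightarrow> u (m + n) x \<le> u m x + u n ((T ^^ m) x)"
  by (simp add: subadditive_cocycle_def)

lemma birkhoff_sum_add:
  "birkhoff_sum T f (m + n) x = birkhoff_sum T f m x + birkhoff_sum T f n ((T ^^ m) x)"
proof (induction n)
  case (Suc n)
  have "(T ^^ (m + n)) x = (T ^^ n) ((T ^^ m) x)"
    by (metis add.commute comp_apply funpow_add)
  then show ?case using Suc by (simp add: birkhoff_sum_def)
qed (simp add: birkhoff_sum_def)

lemma birkhoff_sum_nonneg: "(\<And>x. 0 \<le> f x) \<Longrightarrow> 0 \<le> birkhoff_sum T f n x"
  by (simp add: birkhoff_sum_def sum_nonneg)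

text \<open>Splitting off one step at a time bounds \<open>u N / N\<close> by a constant that does
  not depend on \<open>N\<close>. The successor matters: subadditivity forces \<open>u 0\<close> to
  be nonnegative, and it may be positive.\<close>

lemma subadditive_cocycle_le_mult:
  assumes "subadditive_cocycle T u" "\<And>x. u 1 x \<le> K"
  shows "u (Suc n) x \<le> real (Suc n) * K"
proof (induction n arbitrary: x)
  case (Suc n)
  have "u (Suc (Suc n)) x \<le> u 1 x + u (Suc n) ((T ^^ 1) x)"
    using subadditive_cocycleD[OF assms(1), of 1 "Suc n" x] by simp
  also have "\<dots> \<le> K + real (Suc n) * K"
    by (intro add_mono assms(2) Suc)
  finally show ?case by (simp add: algebra_simps)
qed (use assms(2) in simp)

text \<open>The cocycle is split into blocks of length \<open>N\<close> with each of the \<open>N\<close> possible offsets, and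
  the resulting bounds are added up.\<close>

lemma subadditive_cocycle_le_birkhoff_sum:
  assumes u: "subadditive_cocycle T u" and "N > 0"
    and B: "\<And>i x. i \<le> 2 * N \<Longrightarrow> \<bar>u i x\<bar> \<le> B"
  shows "real N * u m x \<le> birkhoff_sum T (u N) m x + 4 * real N * B"
proof -
  define b where "b m x = (\<Sum>i<N. u (m - i) ((T ^^ i) x))" for m x
  have B0: "0 \<le> B" using B[of 0 undefined] by simp
  have small: "- (2 * real N * B) \<le> birkhoff_sum T (u N) m x" if "m \<le> 2 * N" for m x
  proof -
    have "(\<Sum>i<m. - B) \<le> birkhoff_sum T (u N) m x"
      unfolding birkhoff_sum_def
    proof (rule sum_mono)
      show "- B \<le> u N ((T ^^ i) x)" for i
        using B[of N "(T ^^ i) x"] by simp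
    qed
    moreover have "real m * B \<le> (2 * real N) * B"
      using that B0 by (intro mult_right_mono) linarith+
    ultimately show ?thesis by simp
  qed
  have b: "b m x \<le> birkhoff_sum T (u N) m x + 3 * real N * B" for m x
  proof (induction m arbitrary: x rule: less_induct)
    case (less m)
    show ?case
    proof (cases "m \<le> 2 * N")
      case True
      have "b m x \<le> (\<Sum>i<N. B)"
        unfolding b_def
      proof (rule sum_mono)
        show "u (m - i) ((T ^^ i) x) \<le> B" for i
          using B[of "m - i" "(T ^^ i) x"] True by linarith
      qed
      then show ?thesis using small[OF True, of x] by simp
    next
      case False
      \<comment> \<open>Each offset \<open>i < N\<close> leaves room for a whole block of length
        \<open>N\<close>. The \<open>N\<close> split-off blocks start at successive points of the
        orbit, so together they form a Birkhoff sum of length \<open>N\<close>, and the remainders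
        form \<open>b\<close> at \<open>(T ^^ N) x\<close>.\<close>
      have "b m x \<le> (\<Sum>i<N. u N ((T ^^ i) x) + u (m - N - i) ((T ^^ i) ((T ^^ N) x)))"
        unfolding b_def
      proof (rule sum_mono)
        fix i assume "i \<in> {..<N}"
        then have "m - i = N + (m - N - i)" using False by simp
        moreover have "(T ^^ N) ((T ^^ i) x) = (T ^^ i) ((T ^^ N) x)"
          by (metis add.commute comp_apply funpow_add)
        ultimately show "u (m - i) ((T ^^ i) x)
            \<le> u N ((T ^^ i) x) + u (m - N - i) ((T ^^ i) ((T ^^ N) x))"
          using subadditive_cocycleD[OF u, of N "m - N - i" "(T ^^ i) x"] by simp
      qed
      also have "\<dots> = birkhoff_sum T (u N) N x + b (m - N) ((T ^^ N) x)"
        by (simp add: sum.distrib birkhoff_sum_def b_def)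
      also have "\<dots> \<le> birkhoff_sum T (u N) N x
          + (birkhoff_sum T (u N) (m - N) ((T ^^ N) x) + 3 * real N * B)"
        using less[of "m - N" "(T ^^ N) x"] \<open>N > 0\<close> False by simp
      also have "\<dots> = birkhoff_sum T (u N) m x + 3 * real N * B"
        using birkhoff_sum_add[of T "u N" N "m - N" x] False by simp
      finally show ?thesis .
    qed
  qed
  show ?thesis
  proof (cases "m \<le> 2 * N")
    case True
    have "real N * u m x \<le> real N * B"
      using B[OF True, of x] by (intro mult_left_mono) auto
    moreover have "0 \<le> real N * B" using B0 by simp
    ultimately show ?thesis using small[OF True, of x] by linarith
  next
    case False
    \<comment> \<open>Averaging over the offsets: the initial piece of length \<open>i\<close> costs
      at most \<open>B\<close>.\<close>
    have "(\<Sum>i<N. u m x) \<le> (\<Sum>i<N. B + u (m - i) ((T ^^ i) x))"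
    proof (rule sum_mono)
      fix i assume "i \<in> {..<N}"
      then show "u m x \<le> B + u (m - i) ((T ^^ i) x)"
        using subadditive_cocycleD[OF u, of i "m - i" x] B[of i x] False by simp
    qed
    then have "real N * u m x \<le> real N * B + b m x"
      by (simp add: sum.distrib b_def)
    then show ?thesis using b[of m x] by simp
  qed
qed

section \<open>Greedy selection of disjoint bad intervals\<close>

text \<open>Here \<open>l\<close> is the total length of the intervals in the greedy cover and \<open>k\<close> is the
  endpoint of the last one, which may lie beyond \<open>n\<close>.\<close>

lemma subadditive_cocycle_greedy_cover:
  fixes a D :: real
  assumes w: "subadditive_cocycle T w" and D: "\<And>m x. w m x \<le> D"
    and bad: "\<And>x. bad x \<Longrightarrow> \<exists>m>0. w m x \<le> - a * real m - D"
    and "\<exists>j<n. bad ((T ^^ j) x)"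
  shows "\<exists>k l. card {j\<in>{..<n}. bad ((T ^^ j) x)} \<le> l \<and> l \<le> k \<and> k \<le> n + l
    \<and> w k x \<le> - a * real l"
  using assms(4)
proof (induction n arbitrary: x rule: less_induct)
  case (less n)
  define j where "j = (LEAST j. bad ((T ^^ j) x))"
  from less.prems have badj: "bad ((T ^^ j) x)" and "j < n"
    unfolding j_def by (auto intro: LeastI le_less_trans[OF Least_le])
  have least: "j \<le> i" if "bad ((T ^^ i) x)" for i
    unfolding j_def using that by (rule Least_le)
  obtain m where m: "m > 0" "w m ((T ^^ j) x) \<le> - a * real m - D"
    using bad[OF badj] by auto
  define y where "y = (T ^^ (j + m)) x"
  define S where "S = {i\<in>{..<n - (j + m)}. bad ((T ^^ i) y)}"
  have wjm: "w (j + m) x \<le> - a * real m"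
    using subadditive_cocycleD[OF w, of j m x] D[of j x] m by simp
  have y: "(T ^^ i) y = (T ^^ (i + (j + m))) x" for i
    unfolding y_def by (simp add: funpow_add)
  \<comment> \<open>By minimality of \<open>j\<close>, a bad time before \<open>j + m\<close> lies
    in the chosen interval; a later one is a shifted bad time of \<open>y\<close>.\<close>
  have "{i\<in>{..<n}. bad ((T ^^ i) x)} \<subseteq> {j..<j + m} \<union> (\<lambda>i. i + (j + m)) ` S"
  proof
    fix i assume i: "i \<in> {i\<in>{..<n}. bad ((T ^^ i) x)}"
    show "i \<in> {j..<j + m} \<union> (\<lambda>i. i + (j + m)) ` S"
    proof (cases "i < j + m")
      case True
      then show ?thesis using i least by auto
    next
      case False
      then have "i - (j + m) \<in> S" "i = (i - (j + m)) + (j + m)"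
        using i by (auto simp: S_def y)
      then show ?thesis by blast
    qed
  qed
  moreover have "finite S" by (simp add: S_def)
  ultimately have "card {i\<in>{..<n}. bad ((T ^^ i) x)}
      \<le> card ({j..<j + m} \<union> (\<lambda>i. i + (j + m)) ` S)"
    by (intro card_mono) auto
  also have "\<dots> \<le> m + card S"
    using card_Un_le[of "{j..<j + m}" "(\<lambda>i. i + (j + m)) ` S"]
      card_image_le[OF \<open>finite S\<close>, of "\<lambda>i. i + (j + m)"] by simp
  finally have card: "card {i\<in>{..<n}. bad ((T ^^ i) x)} \<le> m + card S" .
  show ?case
  \<comment> \<open>If no bad time remains, the cover stops at \<open>j + m\<close>, and
    \<open>j < n\<close> gives \<open>k \<le> n + l\<close> even when the interval overshoots
    \<open>n\<close>. Otherwise \<open>j + m < n\<close>, so the subtraction is not truncated and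
    the two bounds add up.\<close>
  proof (cases "S = {}")
    case True
    then show ?thesis
      using card wjm \<open>j < n\<close> by (intro exI[of _ "j + m"] exI[of _ m]) auto
  next
    case False
    then have "\<exists>i<n - (j + m). bad ((T ^^ i) y)" by (auto simp: S_def)
    moreover from this have *: "j + m < n" by auto
    ultimately obtain k l where kl: "card S \<le> l" "l \<le> k" "k \<le> n - (j + m) + l"
        "w k y \<le> - a * real l"
      using less.IH[of "n - (j + m)" y] \<open>m > 0\<close> unfolding S_def by auto
    have "w (j + m + k) x \<le> - a * real (m + l)"
      using subadditive_cocycleD[OF w, of "j + m" k x] wjm kl(4)
      by (simp add: y_def algebra_simps)
    then show ?thesis
      using card kl * by (intro exI[of _ "j + m + k"] exI[of _ "m + l"]) auto
  qed
qed

text \<open>The greedy cover has \<open>l \<ge> d * n\<close> and \<open>k \<le> n + l\<close>,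
  hence \<open>d * k \<le> (1 + d) * l\<close>: the intervals fill at least the fraction
  \<open>d / (1 + d)\<close> of the time up to \<open>k\<close>, and the descent is linear in
  \<open>k\<close>.\<close>

lemma subadditive_cocycle_many_bad:
  fixes a D d :: real
  assumes w: "subadditive_cocycle T w" and D: "\<And>m x. w m x \<le> D" and "a \<ge> 0" "d > 0" "n > 0"
    and bad: "\<And>x. bad x \<Longrightarrow> \<exists>m>0. w m x \<le> - a * real m - D"
    and many: "real (card {j\<in>{..<n}. bad ((T ^^ j) x)}) \<ge> d * real n"
  shows "\<exists>k. real k \<ge> d * real n \<and> w k x \<le> - a * (d / (1 + d)) * real k"
proof -
  have "card {j\<in>{..<n}. bad ((T ^^ j) x)} \<noteq> 0"
    using many \<open>d > 0\<close> \<open>n > 0\<close> mult_pos_pos[of d "real n"] by linarith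
  then have "\<exists>j<n. bad ((T ^^ j) x)"
    by (auto simp: card_eq_0_iff)
  then obtain k l where kl: "card {j\<in>{..<n}. bad ((T ^^ j) x)} \<le> l" "l \<le> k" "k \<le> n + l"
      "w k x \<le> - a * real l"
    using subadditive_cocycle_greedy_cover[where bad = bad, OF w D bad] by blast
  have "d * real n \<le> real l" using kl(1) many by linarith
  moreover have "d * real k \<le> d * real n + d * real l"
    using mult_left_mono[of "real k" "real n + real l" d] kl(3) \<open>d > 0\<close> by (simp add: distrib_left)
  ultimately have "d * real k \<le> (1 + d) * real l" by (simp add: algebra_simps)
  then have "d / (1 + d) * real k \<le> real l"
    using \<open>d > 0\<close> by (simp add: field_simps)
  then have "a * (d / (1 + d) * real k) \<le> a * real l"
    using \<open>a \<ge> 0\<close> by (rule mult_left_mono)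
  moreover have "real k \<ge> d * real n" using \<open>d * real n \<le> real l\<close> kl(2) by linarith
  ultimately show ?thesis using kl(4) by (intro exI[of _ k]) (simp add: mult.assoc)
qed

section \<open>Domination by Birkhoff sums of small mean\<close>

text \<open>Large deviations at one large time \<open>N\<close> confine the support of the positive
  part of \<open>u N / N - e\<close> to a set of small measure. This function is bounded
  independently of \<open>N\<close>, so its mean is small. Bounding \<open>u 0\<close> by
  \<open>D\<close> as well later excludes time 0 from the supremum.\<close>

lemma subadditive_cocycle_le_mean:
  assumes "compact (UNIV :: 'a::topological_space set)"
    and M: "sets M = sets borel" and "prob_space M"
    and u: "subadditive_cocycle T u"
    and cont: "\<And>n. continuous_on UNIV (u n)"
    and ld: "exp_large_deviations M u 0"
    and "e > 0" "c > 0"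
  shows "\<exists>h D. continuous_on UNIV h \<and> (\<forall>x. 0 \<le> h x) \<and> (\<integral>x. h x \<partial>M) \<le> c
    \<and> (\<forall>m x. \<bar>u 0 (x::'a)\<bar> \<le> D \<and> u m x \<le> e * real m + birkhoff_sum T h m x + D)"
proof -
  interpret prob_space M by fact
  have bnd: "\<exists>K. \<forall>x. \<bar>f x\<bar> \<le> K" if "continuous_on UNIV f" for f :: "'a \<Rightarrow> real"
    using compact_imp_bounded[OF compact_continuous_image[OF that assms(1)]]
    by (auto simp: bounded_iff)
  then have "\<forall>n. \<exists>K. \<forall>x. \<bar>u n x\<bar> \<le> K" using cont by blast
  then obtain U where U: "\<And>n x. \<bar>u n x\<bar> \<le> U n" by metis
  define K where "K = U 1"
  have K: "u 1 x \<le> K" for x using U[of 1 x] by (simp add: K_def)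
  have K0: "0 \<le> K" using U[of 1 undefined] by (simp add: K_def)
  obtain C where C: "C > 0"
    "\<And>n. measure M {x \<in> space M. \<bar>u n x - real n * 0\<bar> \<ge> real n * e} \<le> C * exp (- (real n / C))"
    using ld \<open>e > 0\<close> unfolding exp_large_deviations_def by blast
  \<comment> \<open>Neither \<open>K\<close> nor \<open>C\<close> depends on the time, so
    \<open>N\<close> can be chosen after both.\<close>
  have "(\<lambda>n. K * (C * exp (- (real n / C)))) \<longlonglongrightarrow> 0"
    using \<open>C > 0\<close> by real_asymp
  then have "\<forall>\<^sub>F n in sequentially. K * (C * exp (- (real n / C))) < c"
    using \<open>c > 0\<close> by (rule order_tendstoD(2))
  with eventually_gt_at_top[of 0]
  have "\<forall>\<^sub>F n in sequentially. 0 < n \<and> K * (C * exp (- (real n / C))) < c"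
    by (rule eventually_conj)
  then obtain N where N: "N > 0" "K * (C * exp (- (real N / C))) < c"
    by (auto simp: eventually_at_top_linorder)
  define h where "h x = max (u N x / real N - e) 0" for x
  define A where "A = {x \<in> space M. \<bar>u N x - real N * 0\<bar> \<ge> real N * e}"
  define B where "B = (\<Sum>i\<le>2 * N. U i)"
  have B: "\<bar>u i x\<bar> \<le> B" if "i \<le> 2 * N" for i x
  proof -
    have "U i \<le> B" unfolding B_def
      using that U by (intro member_le_sum) (auto intro: order_trans[OF abs_ge_zero])
    then show ?thesis using U[of i x] by simp
  qed
  have conth: "continuous_on UNIV h"
    unfolding h_def by (intro continuous_intros cont) (use N in auto)
  have meas: "f \<in> borel_measurable M" if "continuous_on UNIV f" for f :: "'a \<Rightarrow> real"
    using borel_measurable_continuous_onI[OF that] M measurable_cong_sets by blast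
  note [measurable] = meas[OF conth] meas[OF cont]
  have A: "A \<in> sets M" unfolding A_def by measurable
  have hle: "h x \<le> K * indicator A x" if "x \<in> space M" for x
  proof (cases "x \<in> A")
    case True
    have "u N x \<le> real N * K"
      using subadditive_cocycle_le_mult[OF u K, of "N - 1" x] N by simp
    then have "u N x / real N \<le> K" using N by (simp add: field_simps)
    then show ?thesis using True K0 \<open>e > 0\<close> by (simp add: h_def)
  next
    case False
    then have "u N x < real N * e" using that by (auto simp: A_def)
    then have "u N x / real N \<le> e" using N by (simp add: field_simps)
    then show ?thesis using False by (simp add: h_def)
  qed
  have "(\<integral>x. h x \<partial>M) \<le> (\<integral>x. K * indicator A x \<partial>M)"
    using A hle by (intro integral_mono_AE' integrable_mult_right integrable_real_indicator)
      (auto simp: h_def emeasure_eq_measure)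
  also have "\<dots> = K * measure M A" using A by simp
  also have "\<dots> \<le> K * (C * exp (- (real N / C)))"
    unfolding A_def by (intro mult_left_mono C K0)
  finally have "(\<integral>x. h x \<partial>M) \<le> c" using N by simp
  moreover have "u m x \<le> e * real m + birkhoff_sum T h m x + 4 * B" for m x
  proof -
    have "birkhoff_sum T (u N) m x \<le> (\<Sum>i<m. real N * (e + h ((T ^^ i) x)))"
      unfolding birkhoff_sum_def
    proof (rule sum_mono)
      fix i
      have "u N ((T ^^ i) x) / real N \<le> e + h ((T ^^ i) x)" by (simp add: h_def)
      then show "u N ((T ^^ i) x) \<le> real N * (e + h ((T ^^ i) x))"
        using N by (simp add: field_simps)
    qed
    also have "\<dots> = real N * (e * real m + birkhoff_sum T h m x)"
      by (simp add: birkhoff_sum_def sum.distrib flip: sum_distrib_left)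
    finally have "real N * u m x \<le> real N * (e * real m + birkhoff_sum T h m x + 4 * B)"
      using subadditive_cocycle_le_birkhoff_sum[where u = u and B = B, OF u \<open>N > 0\<close> B, of m x]
      by (simp add: algebra_simps)
    then show ?thesis using N by simp
  qed
  moreover have "\<bar>u 0 x\<bar> \<le> 4 * B" for x using B[of 0 x] by simp
  ultimately show ?thesis using conth by (intro exI[of _ h] exI[of _ "4 * B"]) (auto simp: h_def)
qed

section \<open>Exponential tails and the final estimate\<close>

text \<open>A geometric tail keeps the rate of its first term. The union is needed because the time
  of the deviation depends on the point and is only bounded below.\<close>

lemma (in finite_measure) measure_UN_atLeast_exp_bound:
  assumes E: "\<And>k. E k \<in> sets M" and bound: "\<And>k. measure M (E k) \<le> C * exp (- (real k / C))"
    and "C > 0"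
  shows "measure M (\<Union>k\<in>{K..}. E k) \<le> C / (1 - exp (- (1 / C))) * exp (- (real K / C))"
proof -
  define r where "r = exp (- (1 / C))"
  have r: "0 < r" "r < 1" using \<open>C > 0\<close> by (auto simp: r_def)
  have exp_r: "exp (- (real k / C)) = r ^ k" for k
    by (simp add: r_def flip: exp_of_nat_mult)
  have sums: "(\<lambda>i. C * r ^ K * r ^ i) sums (C * r ^ K * (1 / (1 - r)))"
    using r by (intro sums_mult geometric_sums) simp
  have le: "measure M (E (i + K)) \<le> C * r ^ K * r ^ i" for i
    using bound[of "i + K"] unfolding exp_r by (simp add: power_add algebra_simps)
  have summ: "summable (\<lambda>i. measure M (E (i + K)))"
    using le by (intro summable_comparison_test'[OF sums_summable[OF sums], of 0]) auto
  have "(\<Union>k\<in>{K..}. E k) = (\<Union>i. E (i + K))"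
  proof (intro equalityI subsetI)
    fix x assume "x \<in> (\<Union>k\<in>{K..}. E k)"
    then obtain k where "K \<le> k" "x \<in> E k" by auto
    then have "x \<in> E (k - K + K)" by simp
    then show "x \<in> (\<Union>i. E (i + K))" by blast
  qed auto
  then have "measure M (\<Union>k\<in>{K..}. E k) \<le> (\<Sum>i. measure M (E (i + K)))"
    using E summ by (simp add: finite_measure_subadditive_countably image_subset_iff)
  also have "\<dots> \<le> (\<Sum>i. C * r ^ K * r ^ i)"
    by (intro suminf_le le summ sums_summable[OF sums])
  also have "\<dots> = C * r ^ K * (1 / (1 - r))"
    using sums by (simp add: sums_iff)
  finally show ?thesis unfolding exp_r by (simp add: r_def)
qed

theorem theorem4p1:
  fixes M :: "'a::topological_space measure"
    and T :: "'a \<Rightarrow> 'a"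
    and u :: "nat \<Rightarrow> 'a \<Rightarrow> real"
    and \<epsilon> \<delta> :: real
  assumes "compact (UNIV :: 'a set)"
    and "sets M = sets borel"
    and "continuous_on UNIV T"
    and "ergodic_system M T"
    and "subadditive_cocycle T u"
    and "AE x in M. (\<lambda>n. u n x / real n) \<longlonglongrightarrow> 0"
    and "\<And>n. continuous_on UNIV (u n)"
    and "\<epsilon> > 0"
    and "exp_large_deviations M u 0"
    and "\<And>f :: 'a \<Rightarrow> real. continuous_on UNIV f \<Longrightarrow>
           exp_large_deviations M (birkhoff_sum T f) (\<integral>x. f x \<partial>M)"
    and "\<delta> > 0"
  shows "\<exists>C>0. \<forall>n.
    measure M {x \<in> space M. real (card {j \<in> {..<n}. sup_excess u \<epsilon> ((T ^^ j) x) > ereal C}) \<ge> \<delta> * real n}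
      \<le> C * exp (- (real n / C))"
proof -
  interpret ergodic_system M T by fact
  \<comment> \<open>The proportion \<open>\<delta>\<close> is shared between two kinds of bad
    points, and \<open>q\<close> is the fraction of time filled by greedy intervals. Since
    \<open>\<epsilon> * q = 8 * c\<close>, there is room for the slack \<open>c\<close>, the mean of
    \<open>h\<close> and the deviations.\<close>
  define d where "d = \<delta> / 2"
  define q where "q = d / (1 + d)"
  define c where "c = \<epsilon> * q / 8"
  have "d > 0" using \<open>\<delta> > 0\<close> by (simp add: d_def)
  then have "c > 0" using \<open>\<epsilon> > 0\<close> by (simp add: c_def q_def)
  have "\<epsilon> * q \<le> \<epsilon>"
    using \<open>\<epsilon> > 0\<close> \<open>d > 0\<close> unfolding q_def by (intro mult_left_le) auto
  then have "c \<le> \<epsilon> / 8"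
    unfolding c_def by (intro divide_right_mono) auto
  then have "c \<le> \<epsilon> / 2" using \<open>\<epsilon> > 0\<close> by simp
  obtain h D where conth: "continuous_on UNIV h" and h0: "\<And>x. 0 \<le> h x"
    and int_h: "(\<integral>x. h x \<partial>M) \<le> c" and D0: "\<And>x. \<bar>u 0 x\<bar> \<le> D"
    and uD: "\<And>m x. u m x \<le> c * real m + birkhoff_sum T h m x + D"
    using subadditive_cocycle_le_mean[OF assms(1,2) prob_space_axioms assms(5,7,9) \<open>c > 0\<close> \<open>c > 0\<close>]
    by blast
  \<comment> \<open>Subtracting additive terms preserves subadditivity and yields the uniform upper
    bound \<open>D\<close> that the greedy cover requires.\<close>
  define w where "w m x = u m x - c * real m - birkhoff_sum T h m x" for m x
  have w: "subadditive_cocycle T w"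
    using subadditive_cocycleD[OF assms(5)] birkhoff_sum_add[of T h]
    by (simp add: subadditive_cocycle_def w_def algebra_simps)
  have wD: "w m x \<le> D" for m x using uD[of m x] by (simp add: w_def)
  have v: "subadditive_cocycle T (\<lambda>m x. - birkhoff_sum T h m x)"
    by (simp add: subadditive_cocycle_def birkhoff_sum_add)
  have v0: "- birkhoff_sum T h m x \<le> 0" for m x
    using birkhoff_sum_nonneg[of h T m x] h0 by simp
  \<comment> \<open>The trailing \<open>- 0\<close> matches the threshold of the counting lemma with
    upper bound 0 for the negated Birkhoff sums.\<close>
  define bad1 where "bad1 x \<longleftrightarrow> (\<exists>m>0. - birkhoff_sum T h m x \<le> - (\<epsilon> / 2) * real m - 0)" for x
  define bad2 where "bad2 x \<longleftrightarrow> (\<exists>m>0. w m x \<le> - \<epsilon> * real m - D)" for x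
  have bad: "bad1 x \<or> bad2 x" if "sup_excess u \<epsilon> x > ereal C" "C \<ge> D" for x C
  proof -
    from that obtain m where m: "\<bar>u m x\<bar> - \<epsilon> * real m > C"
      unfolding sup_excess_def by (auto simp: less_SUP_iff)
    have "m > 0" using m D0[of x] that(2) by (cases m) auto
    have cm: "c * real m \<le> \<epsilon> / 2 * real m"
      using \<open>c \<le> \<epsilon> / 2\<close> by (intro mult_right_mono) auto
    have cm0: "0 \<le> c * real m" using \<open>c > 0\<close> by simp
    show ?thesis
    \<comment> \<open>A large positive \<open>u m x\<close> forces a large Birkhoff sum, since the
      slack \<open>c * m\<close> uses at most half of \<open>\<epsilon> * m\<close>. A very negative
      one makes \<open>w\<close> at least as negative, and \<open>C \<ge> D\<close> supplies the
      term \<open>- D\<close>.\<close>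
    proof (cases "u m x \<ge> 0")
      case True
      then have "- birkhoff_sum T h m x \<le> - (\<epsilon> / 2) * real m - 0"
        using m that(2) uD[of m x] cm by simp
      then show ?thesis using \<open>m > 0\<close> unfolding bad1_def by blast
    next
      case False
      then have "w m x \<le> - \<epsilon> * real m - D"
        using m that(2) cm0 v0[of m x] by (simp add: w_def)
      then show ?thesis using \<open>m > 0\<close> unfolding bad2_def by blast
    qed
  qed
  define l where "l = (\<integral>x. h x \<partial>M)"
  define E1 where "E1 k = {x \<in> space M. \<bar>birkhoff_sum T h k x - real k * l\<bar> \<ge> real k * c}" for k
  define E2 where "E2 k = {x \<in> space M. \<bar>u k x - real k * 0\<bar> \<ge> real k * c}" for k
  have lc: "real k * l \<le> real k * c" for k
    using int_h by (simp add: l_def mult_left_mono)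
  have E: "x \<in> (\<Union>k\<in>{nat \<lceil>d * real n\<rceil>..}. E1 k) \<union> (\<Union>k\<in>{nat \<lceil>d * real n\<rceil>..}. E2 k)"
    if "x \<in> space M" "n > 0" "C \<ge> D"
      and many: "real (card {j \<in> {..<n}. sup_excess u \<epsilon> ((T ^^ j) x) > ereal C}) \<ge> \<delta> * real n"
    for x n C
  proof -
    define J where "J b = {j \<in> {..<n}. b ((T ^^ j) x)}" for b
    have "{j \<in> {..<n}. sup_excess u \<epsilon> ((T ^^ j) x) > ereal C} \<subseteq> J bad1 \<union> J bad2"
      using bad \<open>C \<ge> D\<close> by (auto simp: J_def)
    then have "card {j \<in> {..<n}. sup_excess u \<epsilon> ((T ^^ j) x) > ereal C} \<le> card (J bad1 \<union> J bad2)"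
      by (intro card_mono) (auto simp: J_def)
    also have "\<dots> \<le> card (J bad1) + card (J bad2)" by (rule card_Un_le)
    finally have "\<delta> * real n \<le> real (card (J bad1)) + real (card (J bad2))"
      using many by linarith
    then consider "real (card (J bad1)) \<ge> d * real n" | "real (card (J bad2)) \<ge> d * real n"
      unfolding d_def by linarith
    then show ?thesis
    proof cases
      case 1
      then obtain k where k: "real k \<ge> d * real n"
          "- birkhoff_sum T h k x \<le> - (\<epsilon> / 2) * q * real k"
        using subadditive_cocycle_many_bad[OF v v0 _ \<open>d > 0\<close> \<open>n > 0\<close>, of "\<epsilon> / 2" bad1 x]
          \<open>\<epsilon> > 0\<close> unfolding J_def bad1_def q_def by auto
      have "birkhoff_sum T h k x \<ge> 4 * (real k * c)"
        using k(2) by (simp add: c_def algebra_simps)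
      moreover have "0 \<le> real k * c" using \<open>c > 0\<close> by simp
      ultimately have "real k * c \<le> \<bar>birkhoff_sum T h k x - real k * l\<bar>"
        using lc[of k] by linarith
      then have "x \<in> E1 k" using \<open>x \<in> space M\<close> by (simp add: E1_def)
      then show ?thesis using k(1) by (auto simp: nat_le_iff ceiling_le_iff)
    next
      case 2
      then obtain k where k: "real k \<ge> d * real n" "w k x \<le> - \<epsilon> * q * real k"
        using subadditive_cocycle_many_bad[OF w wD _ \<open>d > 0\<close> \<open>n > 0\<close>, of \<epsilon> bad2 x]
          \<open>\<epsilon> > 0\<close> unfolding J_def bad2_def q_def by auto
      have wk: "w k x \<le> - 8 * (real k * c)"
        using k(2) by (simp add: c_def algebra_simps)
      have "x \<in> E1 k \<or> x \<in> E2 k"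
      \<comment> \<open>From \<open>w \<le> - 8 * (k * c)\<close>: either the Birkhoff sum exceeds
        its mean by \<open>k * c\<close>, or undoing the subtraction adds less than
        \<open>3 * (k * c)\<close> and leaves \<open>u\<close> below
        \<open>- 5 * (k * c)\<close>.\<close>
      proof (cases "birkhoff_sum T h k x \<ge> 2 * (real k * c)")
        case True
        then have "real k * c \<le> \<bar>birkhoff_sum T h k x - real k * l\<bar>" using lc[of k] by linarith
        then show ?thesis using \<open>x \<in> space M\<close> by (simp add: E1_def)
      next
        case False
        then have "u k x \<le> - 5 * (real k * c)" using wk by (simp add: w_def algebra_simps)
        moreover have "0 \<le> real k * c" using \<open>c > 0\<close> by simp
        ultimately have "real k * c \<le> \<bar>u k x\<bar>" by linarith
        then show ?thesis using \<open>x \<in> space M\<close> by (simp add: E2_def)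
      qed
      then show ?thesis using k(1) by (auto simp: nat_le_iff ceiling_le_iff)
    qed
  qed
  have meas: "f \<in> borel_measurable M" if "continuous_on UNIV f" for f :: "'a \<Rightarrow> real"
    using borel_measurable_continuous_onI[OF that] assms(2) measurable_cong_sets by blast
  have [measurable]: "T ^^ j \<in> measurable M M" for j
    by (induction j) (auto intro: measurable_compose T_measurable simp: comp_def)
  note [measurable] = meas[OF conth] meas[OF assms(7)]
  have E1: "E1 k \<in> sets M" for k unfolding E1_def birkhoff_sum_def by measurable
  have E2: "E2 k \<in> sets M" for k unfolding E2_def by measurable
  obtain C1 where C1: "C1 > 0" "\<And>k. measure M (E1 k) \<le> C1 * exp (- (real k / C1))"
    using assms(10)[OF conth] \<open>c > 0\<close> unfolding exp_large_deviations_def E1_def l_def by blast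
  obtain C2 where C2: "C2 > 0" "\<And>k. measure M (E2 k) \<le> C2 * exp (- (real k / C2))"
    using assms(9) \<open>c > 0\<close> unfolding exp_large_deviations_def E2_def by blast
  define A1 where "A1 = C1 / (1 - exp (- (1 / C1)))"
  define A2 where "A2 = C2 / (1 - exp (- (1 / C2)))"
  have A: "A1 \<ge> 0" "A2 \<ge> 0" using C1(1) C2(1) by (auto simp: A1_def A2_def)
  \<comment> \<open>One constant serves as threshold for the supremum (\<open>D\<close>), prefactor
    (\<open>A1 + A2\<close>) and inverse rate (\<open>C1 / d\<close> and \<open>C2 / d\<close>, as
    the tails start near \<open>d * n\<close>); the 1 settles \<open>n = 0\<close>.\<close>
  define C where "C = max 1 (max D (max (A1 + A2) (max (C1 / d) (C2 / d))))"
  have C: "C \<ge> 1" "C \<ge> D" "C \<ge> A1 + A2" "C \<ge> C1 / d" "C \<ge> C2 / d"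
    by (auto simp: C_def)
  have decay: "exp (- (real (nat \<lceil>d * real n\<rceil>) / B)) \<le> exp (- (real n / C))"
    if "B > 0" "C \<ge> B / d" for B n
  proof -
    have "0 < B / d" using \<open>B > 0\<close> \<open>d > 0\<close> by simp
    then have "real n / C \<le> real n / (B / d)"
      using that(2) by (intro divide_left_mono mult_pos_pos) linarith+
    also have "\<dots> = d * real n / B" by simp
    also have "\<dots> \<le> real (nat \<lceil>d * real n\<rceil>) / B"
      using that(1) by (intro divide_right_mono) linarith+
    finally show ?thesis by simp
  qed
  show ?thesis
  proof (intro exI[of _ C] conjI allI)
    show "C > 0" using C(1) by simp
    fix n
    let ?S = "{x \<in> space M. real (card {j \<in> {..<n}. sup_excess u \<epsilon> ((T ^^ j) x) > ereal C}) \<ge> \<delta> * real n}"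
    define K where "K = nat \<lceil>d * real n\<rceil>"
    show "measure M ?S \<le> C * exp (- (real n / C))"
    proof (cases "n = 0")
      case True
      then show ?thesis using C(1) by (simp add: prob_space)
    next
      case False
      have "?S \<subseteq> (\<Union>k\<in>{K..}. E1 k) \<union> (\<Union>k\<in>{K..}. E2 k)"
        using E[of _ n C] False C(2) unfolding K_def by blast
      \<comment> \<open>Monotonicity asks only the larger set to be measurable.\<close>
      then have "measure M ?S \<le> measure M ((\<Union>k\<in>{K..}. E1 k) \<union> (\<Union>k\<in>{K..}. E2 k))"
        using E1 E2 by (intro finite_measure_mono) auto
      also have "\<dots> \<le> measure M (\<Union>k\<in>{K..}. E1 k) + measure M (\<Union>k\<in>{K..}. E2 k)"
        using E1 E2 by (intro measure_Un_le) auto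
      also have "\<dots> \<le> A1 * exp (- (real K / C1)) + A2 * exp (- (real K / C2))"
        unfolding A1_def A2_def
        by (intro add_mono measure_UN_atLeast_exp_bound E1 E2 C1 C2)
      also have "\<dots> \<le> A1 * exp (- (real n / C)) + A2 * exp (- (real n / C))"
        unfolding K_def by (intro add_mono mult_left_mono decay A C1(1) C2(1) C)
      also have "\<dots> \<le> C * exp (- (real n / C))"
        using C(3) by (simp flip: distrib_right)
      finally show ?thesis .
    qed
  qed
qed

end
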